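(* Let $\{X_t\}_{t\in\mathbb{Z}}$ be a stationary FIEGARCH$(p,d,q)$ process with $d<0.5$. If $\mathbb{E}(|X_0|^3)<\infty$, then the asymmetry measure $A_X:=\mathbb{E}(X_t^3)/[\mathbb{E}(X_t^2)]^{3/2}$ is given by $$A_X=\mathbb{E}(Z_0^3)\,\frac{\prod_{k=0}^\infty\mathbb{E}\big(\exp\{\tfrac32\lambda_{d,k}g(Z_0)\}\big)}{\big[\prod_{k=0}^\infty\mathbb{E}\big(\exp\{\lambda_{d,k}g(Z_0)\}\big)\big]^{3/2}},$$ and, if $\mathbb{E}(X_0^4)<\infty$, the kurtosis measure $K_X:=\mathbb{E}(X_t^4)/[\mathbb{E}(X_t^2)]^{2}$ is given by $$K_X=\mathbb{E}(Z_0^4)\,\frac{\prod_{k=0}^\infty\mathbb{E}\big(\exp\{2\lambda_{d,k}g(Z_0)\}\big)}{\big[\prod_{k=0}^\infty\mathbb{E}\big(\exp\{\lambda_{d,k}g(Z_0)\}\big)\big]^{2}}.$$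
   Context: FIEGARCH$(p,d,q)$: let $\{Z_t\}_{t\in\mathbb{Z}}$ be i.i.d. real random variables with mean $0$ and variance $1$; let $d,\omega,\theta,\gamma\in\mathbb{R}$; let $\alpha(z)=1-\sum_{i=1}^p\alpha_iz^i$, $\beta(z)=1-\sum_{j=1}^q\beta_jz^j$ be real polynomials with no common roots and $\beta(z)\neq0$ for $|z|\le1$. Let $\lambda_{d,k}$ be defined by $\frac{\alpha(z)}{\beta(z)}(1-z)^{-d}=\sum_{k=0}^\infty\lambda_{d,k}z^k$ for $|z|<1$, and put $g(Z_t)=\theta Z_t+\gamma\,[\,|Z_t|-\mathbb{E}(|Z_t|)\,]$. Then $X_t=\sigma_tZ_t$ with $\sigma_t>0$ given by $$\ln(\sigma_t^2)=\omega+\sum_{k=0}^\infty\lambda_{d,k}\,g(Z_{t-1-k}),\qquad t\in\mathbb{Z},$$ the series being the almost sure limit of its partial sums. Infinite products are limits of partial products. *)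

theory Defs
  imports "HOL-Probability.Probability" "HOL-Computational_Algebra.Polynomial"
begin

definition lag_poly :: "nat \<Rightarrow> (nat \<Rightarrow> real) \<Rightarrow> real poly" where
  "lag_poly n a = 1 - (\<Sum>i=1..n. monom (a i) i)"

abbreviation cpoly :: "real poly \<Rightarrow> complex \<Rightarrow> complex" where
  "cpoly P z \<equiv> poly (map_poly complex_of_real P) z"

(* The complex power is the principal one; Re (1 - z) > 0 on the unit disc.
   The expansion determines the real sequence lam uniquely. *)
definition fiegarch_coeffs ::
  "real poly \<Rightarrow> real poly \<Rightarrow> real \<Rightarrow> (nat \<Rightarrow> real) \<Rightarrow> bool" where
  "fiegarch_coeffs A B d lam \<longleftrightarrow>
     (\<forall>z::complex. norm z < 1 \<longrightarrow>
        (\<lambda>k. complex_of_real (lam k) * z ^ k) sums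
          (cpoly A z / cpoly B z * (1 - z) powr (- complex_of_real d)))"

definition fiegarch_g ::
  "'a measure \<Rightarrow> real \<Rightarrow> real \<Rightarrow> ('a \<Rightarrow> real) \<Rightarrow> 'a \<Rightarrow> real" where
  "fiegarch_g M \<theta> \<gamma> Y x = \<theta> * Y x + \<gamma> * (\<bar>Y x\<bar> - (\<integral>y. \<bar>Y y\<bar> \<partial>M))"

definition strictly_stationary :: "'a measure \<Rightarrow> (int \<Rightarrow> 'a \<Rightarrow> real) \<Rightarrow> bool" where
  "strictly_stationary M X \<longleftrightarrow>
     (\<forall>t. X t \<in> borel_measurable M) \<and>
     (\<forall>J h. finite J \<longrightarrow>
        distr M (Pi\<^sub>M J (\<lambda>_. borel)) (\<lambda>x. \<lambda>t\<in>J. X (t + h) x) =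
        distr M (Pi\<^sub>M J (\<lambda>_. borel)) (\<lambda>x. \<lambda>t\<in>J. X t x))"

locale fiegarch = prob_space M
  for M :: "'a measure" +
  fixes p q :: nat
    and \<alpha> \<beta> :: "nat \<Rightarrow> real"
    and d \<omega> \<theta> \<gamma> :: real
    and lam :: "nat \<Rightarrow> real"
    and Z \<sigma> X :: "int \<Rightarrow> 'a \<Rightarrow> real"
  assumes Z_indep: "indep_vars (\<lambda>_. borel) Z UNIV"
    and Z_ident: "\<And>t. distr M borel (Z t) = distr M borel (Z 0)"
    and Z_integrable: "\<And>t. integrable M (Z t)"
    and Z_mean: "\<And>t. expectation (Z t) = 0"
    and Z_square_integrable: "\<And>t. integrable M (\<lambda>x. (Z t x)\<^sup>2)"
    and Z_variance: "\<And>t. variance (Z t) = 1"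
    and no_common_roots:
      "\<And>z. \<not> (cpoly (lag_poly p \<alpha>) z = 0 \<and> cpoly (lag_poly q \<beta>) z = 0)"
    and beta_nonzero: "\<And>z. norm z \<le> 1 \<Longrightarrow> cpoly (lag_poly q \<beta>) z \<noteq> 0"
    and coeffs: "fiegarch_coeffs (lag_poly p \<alpha>) (lag_poly q \<beta>) d lam"
    and sigma_measurable: "\<And>t. \<sigma> t \<in> borel_measurable M"
    and sigma_pos: "\<And>t x. x \<in> space M \<Longrightarrow> \<sigma> t x > 0"
    and log_volatility:
      "\<And>t. AE x in M.
         (\<lambda>n. \<omega> + (\<Sum>k<n. lam k * fiegarch_g M \<theta> \<gamma> (Z (t - 1 - int k)) x))
           \<longlonglongrightarrow> ln ((\<sigma> t x)\<^sup>2)"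
    and X_eq: "\<And>t x. x \<in> space M \<Longrightarrow> X t x = \<sigma> t x * Z t x"

definition asymmetry_measure :: "'a measure \<Rightarrow> ('a \<Rightarrow> real) \<Rightarrow> real" where
  "asymmetry_measure M Y = (\<integral>x. (Y x) ^ 3 \<partial>M) / (\<integral>x. (Y x)\<^sup>2 \<partial>M) powr (3/2)"

definition kurtosis_measure :: "'a measure \<Rightarrow> ('a \<Rightarrow> real) \<Rightarrow> real" where
  "kurtosis_measure M Y = (\<integral>x. (Y x) ^ 4 \<partial>M) / (\<integral>x. (Y x)\<^sup>2 \<partial>M)\<^sup>2"

(* Expectations and limits are total in HOL, so products of expectations are
   only meaningful together with this predicate: all expectations
   E(exp(c * lam k * Y)) are finite and their partial products converge. *)
definition exp_moment_prod_converges ::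
  "'a measure \<Rightarrow> real \<Rightarrow> (nat \<Rightarrow> real) \<Rightarrow> ('a \<Rightarrow> real) \<Rightarrow> bool" where
  "exp_moment_prod_converges M c lam Y \<longleftrightarrow>
     (\<forall>k. integrable M (\<lambda>x. exp (c * lam k * Y x))) \<and>
     convergent (\<lambda>n. \<Prod>k<n. \<integral>x. exp (c * lam k * Y x) \<partial>M)"

(* Unlike prodinf, this is the plain limit of the partial products, with no
   condition that the limit be nonzero. *)
definition exp_moment_prod ::
  "'a measure \<Rightarrow> real \<Rightarrow> (nat \<Rightarrow> real) \<Rightarrow> ('a \<Rightarrow> real) \<Rightarrow> real" where
  "exp_moment_prod M c lam Y = lim (\<lambda>n. \<Prod>k<n. \<integral>x. exp (c * lam k * Y x) \<partial>M)"

end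

theory Submission
  imports Defs
begin

text \<open>
  Write \<open>\<sigma>\<^sub>0\<^sup>2 = exp (\<omega> + S)\<close> with \<open>S\<close> the sum of the independent terms \<open>\<lambda>\<^sub>k g(Z\<^sub>-\<^sub>1\<^sub>-\<^sub>k)\<close>. Since \<open>S\<close> is
  independent of \<open>Z\<^sub>0\<close>, a finite absolute \<open>m\<close>-th moment of \<open>X\<^sub>0\<close> splits into finite moments
  \<open>E exp (m/2 S)\<close> and \<open>E |Z\<^sub>0|^m\<close>, and the factor \<open>exp (m/2 \<omega>)\<close> cancels in the ratio. It remains to see
  that \<open>E exp (c S)\<close> is the limit of the partial products \<open>P\<^sub>n = E exp (c S\<^sub>n)\<close>. Fatou's lemma for
  \<open>S\<^sub>n \<longlongrightarrow> S\<close> gives \<open>E exp (c S) \<le> liminf P\<^sub>n\<close>. The tail \<open>S - S\<^sub>n\<close> is independent of \<open>S\<^sub>n\<close> and tends to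
  0, so Fatou's lemma for the tail gives \<open>liminf (E exp (c S) / P\<^sub>n) \<ge> 1\<close>, the opposite bound.
\<close>

section \<open>Independence and Fatou tools\<close>

text \<open>Injectivity of \<open>f\<close> makes the singleton blocks \<open>{f j}\<close>
  disjoint, so grouping the family into these blocks preserves independence; reading off the only
  coordinate of each block gives back \<open>X (f j)\<close>.\<close>

lemma (in prob_space) indep_vars_reindex:
  assumes "indep_vars M' X I" "inj_on f J" "f ` J \<subseteq> I"
  shows "indep_vars (\<lambda>j. M' (f j)) (\<lambda>j. X (f j)) J"
proof -
  have "indep_vars (\<lambda>j. PiM {f j} M') (\<lambda>j x. restrict (\<lambda>i. X i x) {f j}) J"
    using assms
    by (intro indep_vars_restrict) (auto simp: disjoint_family_on_def dest: inj_onD)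
  then have "indep_vars (\<lambda>j. M' (f j)) (\<lambda>j x. (restrict (\<lambda>i. X i x) {f j}) (f j)) J"
    by (rule indep_vars_compose2) (auto intro: measurable_component_singleton)
  then show ?thesis
    by simp
qed

text \<open>For nonnegative independent factors the integral of the product factorizes in
  \<open>ennreal\<close> before anything is known to be finite. A finite product forces both factors
  to be finite only if neither is zero, because there 0 times infinity is 0; hence the two
  conditions \<open>nz\<close>.\<close>

lemma (in prob_space) indep_var_integrable_factors:
  fixes f g :: "'a \<Rightarrow> real"
  assumes ind: "indep_var borel f borel g"
    and nonneg: "\<And>x. 0 \<le> f x" "\<And>x. 0 \<le> g x"
    and int: "integrable M (\<lambda>x. f x * g x)"
    and nz: "\<not> (AE x in M. f x = 0)" "\<not> (AE x in M. g x = 0)"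
  shows "integrable M f" "integrable M g"
proof -
  have [measurable]: "f \<in> borel_measurable M" "g \<in> borel_measurable M"
    using ind by (auto dest: indep_var_rv1 indep_var_rv2)
  have "indep_var borel (ennreal \<circ> f) borel (ennreal \<circ> g)"
    by (rule indep_var_compose[OF ind]) auto
  \<comment> \<open>The pair becomes a family indexed by \<open>bool\<close>, to which the product
    rule for nonnegative integrals applies.\<close>
  then have "indep_vars (\<lambda>_. borel) (case_bool (ennreal \<circ> f) (ennreal \<circ> g)) UNIV"
    unfolding indep_var_def by (rule indep_vars_cong[THEN iffD1, rotated -1]) (auto split: bool.split)
  then have "(\<integral>\<^sup>+x. (\<Prod>b\<in>UNIV. case_bool (ennreal \<circ> f) (ennreal \<circ> g) b x) \<partial>M)
      = (\<Prod>b\<in>UNIV. \<integral>\<^sup>+x. case_bool (ennreal \<circ> f) (ennreal \<circ> g) b x \<partial>M)"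
    by (intro indep_vars_nn_integral) auto
  then have "(\<integral>\<^sup>+x. ennreal (f x) \<partial>M) * (\<integral>\<^sup>+x. ennreal (g x) \<partial>M) = (\<integral>\<^sup>+x. ennreal (f x * g x) \<partial>M)"
    by (simp add: UNIV_bool ennreal_mult nonneg mult.commute comp_def)
  also have "\<dots> < \<infinity>"
    using int nonneg by (simp add: integrable_iff_bounded)
  finally have *: "(\<integral>\<^sup>+x. ennreal (f x) \<partial>M) * (\<integral>\<^sup>+x. ennreal (g x) \<partial>M) < \<infinity>" .
  have le_0: "ennreal (f x) = 0 \<longleftrightarrow> f x = 0" "ennreal (g x) = 0 \<longleftrightarrow> g x = 0" for x
    using nonneg[of x] by (auto simp: ennreal_eq_0_iff intro: antisym)
  have "(\<integral>\<^sup>+x. ennreal (f x) \<partial>M) \<noteq> 0" "(\<integral>\<^sup>+x. ennreal (g x) \<partial>M) \<noteq> 0"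
    using nz by (simp_all add: nn_integral_0_iff_AE le_0)
  with * have "(\<integral>\<^sup>+x. ennreal (f x) \<partial>M) < \<infinity>" "(\<integral>\<^sup>+x. ennreal (g x) \<partial>M) < \<infinity>"
    by (auto simp: ennreal_mult_less_top)
  then show "integrable M f" "integrable M g"
    using nonneg by (auto simp: integrable_iff_bounded)
qed

text \<open>Fatou's lemma phrased as an eventual strict lower bound, so that it serves directly as
  one half of an order-theoretic convergence proof.\<close>

lemma eventually_less_integral_Fatou:
  fixes f :: "nat \<Rightarrow> 'a \<Rightarrow> real"
  assumes int: "\<And>n. integrable M (f n)" "integrable M g"
    and nonneg: "\<And>n x. 0 \<le> f n x"
    and lim: "AE x in M. (\<lambda>n. f n x) \<longlonglongrightarrow> g x"
    and less: "c < integral\<^sup>L M g"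
  shows "eventually (\<lambda>n. c < integral\<^sup>L M (f n)) sequentially"
\<comment> \<open>\<open>ennreal\<close> truncates negative numbers to 0, so strict inequalities
  transfer only for nonnegative \<open>c\<close>; a negative \<open>c\<close> lies below every
  integral here anyway.\<close>
proof (cases "c < 0")
  case True
  then show ?thesis
    by (intro always_eventually allI less_le_trans[OF True] integral_nonneg_AE)
       (simp add: nonneg)
next
  case False
  have [measurable]: "\<And>n. f n \<in> borel_measurable M"
    using int by auto
  have g: "AE x in M. 0 \<le> g x"
    using lim by eventually_elim (rule LIMSEQ_le_const, auto simp: nonneg)
  have "ennreal c < ennreal (integral\<^sup>L M g)"
    using less False by (simp add: ennreal_less_iff)
  also have "\<dots> = (\<integral>\<^sup>+x. ennreal (g x) \<partial>M)"
    using int(2) g by (simp add: nn_integral_eq_integral)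
  also have "\<dots> = (\<integral>\<^sup>+x. liminf (\<lambda>n. ennreal (f n x)) \<partial>M)"
  proof (rule nn_integral_cong_AE)
    show "AE x in M. ennreal (g x) = liminf (\<lambda>n. ennreal (f n x))"
      using lim
      by eventually_elim (auto intro!: lim_imp_Liminf[symmetric] tendsto_ennrealI)
  qed
  also have "\<dots> \<le> liminf (\<lambda>n. \<integral>\<^sup>+x. ennreal (f n x) \<partial>M)"
    by (rule nn_integral_liminf) auto
  also have "\<dots> = liminf (\<lambda>n. ennreal (integral\<^sup>L M (f n)))"
    using int(1) nonneg by (simp add: nn_integral_eq_integral)
  finally have "eventually (\<lambda>n. ennreal c < ennreal (integral\<^sup>L M (f n))) sequentially"
    by (rule less_LiminfD)
  then show ?thesis
    by eventually_elim (use False in \<open>simp add: ennreal_less_iff\<close>)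
qed

section \<open>Exponential moments of an almost surely convergent independent series\<close>

context prob_space
begin

lemma not_AE_eq_0_exp: "\<not> (AE x in M. exp (f x :: real) = 0)"
  by (simp add: AE_False)

text \<open>Neither monotonicity nor an integrable dominating function is assumed for the partial
  sums. Integrability of \<open>exp (S x)\<close> alone first yields finite moments of all heads,
  tails and summands, and then convergence by two one-sided Fatou bounds.\<close>

lemma
  fixes V :: "nat \<Rightarrow> 'a \<Rightarrow> real"
  assumes ind: "indep_vars (\<lambda>_. borel) V UNIV"
    and sums: "AE x in M. (\<lambda>k. V k x) sums S x"
    and int: "integrable M (\<lambda>x. exp (S x))"
  shows integrable_exp_summand: "integrable M (\<lambda>x. exp (V k x))"
    and prod_expectation_exp_tendsto:
      "(\<lambda>n. \<Prod>k<n. expectation (\<lambda>x. exp (V k x))) \<longlonglongrightarrow> expectation (\<lambda>x. exp (S x))"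
proof -
  have [measurable]: "\<And>k. V k \<in> borel_measurable M"
    using ind by (auto simp: indep_vars_def)
  define H where "H n x = (\<Sum>k<n. V k x)" for n x
  \<comment> \<open>Taking the tail as a \<open>suminf\<close> makes it a measurable function of the
    \<open>V k\<close> with index at least \<open>n\<close> at every point, whatever default value
    it has where the series diverges.\<close>
  define R where "R n x = (\<Sum>k. V (k + n) x)" for n x
  have [measurable]: "H n \<in> borel_measurable M" "R n \<in> borel_measurable M" for n
    unfolding H_def[abs_def] R_def[abs_def] by measurable
  have split: "AE x in M. S x = H n x + R n x" for n
    using sums
    by eventually_elim
      (auto simp: H_def R_def sums_iff suminf_split_initial_segment[of _ n] add.commute)
  have H_lim: "AE x in M. (\<lambda>n. H n x) \<longlonglongrightarrow> S x"
    using sums by eventually_elim (simp add: H_def sums_def)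
  have R_lim: "AE x in M. (\<lambda>n. R n x) \<longlonglongrightarrow> 0"
  proof -
    have "AE x in M. \<forall>n. S x = H n x + R n x"
      using split by (simp add: AE_all_countable)
    with H_lim show ?thesis
    proof eventually_elim
      fix x assume "(\<lambda>n. H n x) \<longlonglongrightarrow> S x" and *: "\<forall>n. S x = H n x + R n x"
      then have "(\<lambda>n. S x - H n x) \<longlonglongrightarrow> S x - S x"
        by (intro tendsto_intros)
      moreover have "S x - H n x = R n x" for n
        using * by (metis add_diff_cancel_left')
      ultimately show "(\<lambda>n. R n x) \<longlonglongrightarrow> 0"
        by simp
    qed
  qed
  have exp_H_lim: "AE x in M. (\<lambda>n. exp (H n x)) \<longlonglongrightarrow> exp (S x)"
    using H_lim by eventually_elim (rule tendsto_exp)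
  have exp_R_lim: "AE x in M. (\<lambda>n. exp (R n x)) \<longlonglongrightarrow> 1"
    using R_lim by eventually_elim (use tendsto_exp in fastforce)
  \<comment> \<open>The head reads only indices below \<open>n\<close> and the tail only indices
    \<open>k + n\<close>, so they depend on disjoint blocks.\<close>
  have indep_HR: "indep_var borel (\<lambda>x. exp (H n x)) borel (\<lambda>x. exp (R n x))" for n
  proof -
    have "indep_var (PiM {..<n} (\<lambda>_. borel)) (\<lambda>x. restrict (\<lambda>k. V k x) {..<n})
        (PiM {n..} (\<lambda>_. borel)) (\<lambda>x. restrict (\<lambda>k. V k x) {n..})"
      by (rule indep_var_restrict[OF ind]) auto
    then have "indep_var borel ((\<lambda>w. exp (\<Sum>k<n. w k)) \<circ> (\<lambda>x. restrict (\<lambda>k. V k x) {..<n}))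
        borel ((\<lambda>w. exp (\<Sum>k. w (k + n))) \<circ> (\<lambda>x. restrict (\<lambda>k. V k x) {n..}))"
      by (rule indep_var_compose) measurable
    also have "(\<lambda>w. exp (\<Sum>k<n. w k)) \<circ> (\<lambda>x. restrict (\<lambda>k. V k x) {..<n}) = (\<lambda>x. exp (H n x))"
      by (auto simp: H_def fun_eq_iff intro!: sum.cong)
    also have "(\<lambda>w. exp (\<Sum>k. w (k + n))) \<circ> (\<lambda>x. restrict (\<lambda>k. V k x) {n..}) = (\<lambda>x. exp (R n x))"
      by (auto simp: R_def fun_eq_iff)
    finally show ?thesis .
  qed
  have split_exp: "AE x in M. exp (S x) = exp (H n x) * exp (R n x)" for n
    using split[of n] by eventually_elim (simp add: exp_add)
  have "integrable M (\<lambda>x. exp (H n x) * exp (R n x))" for n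
    using int by (rule integrable_cong_AE_imp) (use split_exp[of n] in auto)
  note fac = indep_var_integrable_factors[OF indep_HR _ _ this not_AE_eq_0_exp not_AE_eq_0_exp]
  have int_H: "integrable M (\<lambda>x. exp (H n x))" and int_R: "integrable M (\<lambda>x. exp (R n x))" for n
    using fac by auto
  show int_V: "integrable M (\<lambda>x. exp (V k x))" for k
  proof -
    \<comment> \<open>A single summand is the last term of \<open>H (Suc k)\<close>, and it is
      independent of the earlier part \<open>H k\<close>; finiteness for \<open>H (Suc k)\<close>
      therefore passes to it.\<close>
    have "indep_var (PiM {..<k} (\<lambda>_. borel)) (\<lambda>x. restrict (\<lambda>k. V k x) {..<k})
        (PiM {k} (\<lambda>_. borel)) (\<lambda>x. restrict (\<lambda>k. V k x) {k})"
      by (rule indep_var_restrict[OF ind]) auto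
    then have "indep_var borel ((\<lambda>w. exp (\<Sum>i<k. w i)) \<circ> (\<lambda>x. restrict (\<lambda>k. V k x) {..<k}))
        borel ((\<lambda>w. exp (w k)) \<circ> (\<lambda>x. restrict (\<lambda>k. V k x) {k}))"
      by (rule indep_var_compose) measurable
    also have "(\<lambda>w. exp (\<Sum>i<k. w i)) \<circ> (\<lambda>x. restrict (\<lambda>k. V k x) {..<k}) = (\<lambda>x. exp (H k x))"
      by (auto simp: H_def fun_eq_iff intro!: sum.cong)
    also have "(\<lambda>w. exp (w k)) \<circ> (\<lambda>x. restrict (\<lambda>k. V k x) {k}) = (\<lambda>x. exp (V k x))"
      by auto
    finally have "indep_var borel (\<lambda>x. exp (H k x)) borel (\<lambda>x. exp (V k x))" .
    moreover have "integrable M (\<lambda>x. exp (H k x) * exp (V k x))"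
      using int_H[of "Suc k"] by (simp add: H_def exp_add)
    ultimately show ?thesis
      by (intro indep_var_integrable_factors(2)[OF _ _ _ _ not_AE_eq_0_exp not_AE_eq_0_exp]) auto
  qed
  have E_H: "expectation (\<lambda>x. exp (H n x)) = (\<Prod>k<n. expectation (\<lambda>x. exp (V k x)))" for n
  proof -
    have "indep_vars (\<lambda>_. borel) (\<lambda>k x. exp (V k x)) {..<n}"
      by (rule indep_vars_compose2[OF indep_vars_subset[OF ind]]) auto
    then show ?thesis
      by (simp add: H_def exp_sum indep_vars_lebesgue_integral int_V)
  qed
  \<comment> \<open>This identity turns a lower bound for the tail moment into an upper bound for
    the head moment.\<close>
  have E_HR: "expectation (\<lambda>x. exp (S x))
      = expectation (\<lambda>x. exp (H n x)) * expectation (\<lambda>x. exp (R n x))" for n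
    unfolding indep_var_lebesgue_integral[OF indep_HR int_H int_R, symmetric]
    by (rule integral_cong_AE) (use int split_exp[of n] in auto)
  have pos_S: "0 < expectation (\<lambda>x. exp (S x))"
    using int by (intro expectation_greater) auto
  have "(\<lambda>n. expectation (\<lambda>x. exp (H n x))) \<longlonglongrightarrow> expectation (\<lambda>x. exp (S x))"
  proof (rule order_tendstoI)
    fix a assume "a < expectation (\<lambda>x. exp (S x))"
    with exp_H_lim show "eventually (\<lambda>n. a < expectation (\<lambda>x. exp (H n x))) sequentially"
      by (intro eventually_less_integral_Fatou[OF int_H int]) auto
  next
    fix a assume a: "expectation (\<lambda>x. exp (S x)) < a"
    \<comment> \<open>The threshold is below 1, the expectation of the almost sure limit of
      \<open>exp (R n x)\<close>. Once the tail moment exceeds it, \<open>E_HR\<close> puts the head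
      moment below \<open>a\<close>.\<close>
    have "expectation (\<lambda>x. exp (S x)) / a < expectation (\<lambda>x. 1)"
      using a pos_S by (simp add: prob_space)
    with exp_R_lim have "eventually (\<lambda>n. expectation (\<lambda>x. exp (S x)) / a
        < expectation (\<lambda>x. exp (R n x))) sequentially"
      by (intro eventually_less_integral_Fatou[OF int_R, where g = "\<lambda>_. 1"]) auto
    then show "eventually (\<lambda>n. expectation (\<lambda>x. exp (H n x)) < a) sequentially"
    proof eventually_elim
      fix n assume "expectation (\<lambda>x. exp (S x)) / a < expectation (\<lambda>x. exp (R n x))"
      then have "expectation (\<lambda>x. exp (H n x)) * expectation (\<lambda>x. exp (R n x))
          < a * expectation (\<lambda>x. exp (R n x))"
        using a pos_S by (simp add: E_HR[of n] pos_divide_less_eq mult.commute)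
      moreover have "0 \<le> expectation (\<lambda>x. exp (R n x))"
        by simp
      ultimately show "expectation (\<lambda>x. exp (H n x)) < a"
        by (rule mult_right_less_imp_less)
    qed
  qed
  then show "(\<lambda>n. \<Prod>k<n. expectation (\<lambda>x. exp (V k x))) \<longlonglongrightarrow> expectation (\<lambda>x. exp (S x))"
    by (simp add: E_H)
qed

end


section \<open>The volatility at time 0 and its independence from the current innovation\<close>

context fiegarch
begin

lemma Z_measurable [measurable]: "Z t \<in> borel_measurable M"
  using Z_integrable by (rule borel_measurable_integrable)

lemma expectation_Z_eq:
  fixes \<phi> :: "real \<Rightarrow> real"
  assumes [measurable]: "\<phi> \<in> borel_measurable borel"
  shows "expectation (\<lambda>x. \<phi> (Z t x)) = expectation (\<lambda>x. \<phi> (Z 0 x))"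
proof -
  have "expectation (\<lambda>x. \<phi> (Z t x)) = integral\<^sup>L (distr M borel (Z t)) \<phi>"
    by (simp add: integral_distr)
  also have "\<dots> = expectation (\<lambda>x. \<phi> (Z 0 x))"
    by (simp add: Z_ident[of t] integral_distr)
  finally show ?thesis .
qed

lemma integrable_Z_iff:
  fixes \<phi> :: "real \<Rightarrow> real"
  assumes [measurable]: "\<phi> \<in> borel_measurable borel"
  shows "integrable M (\<lambda>x. \<phi> (Z t x)) \<longleftrightarrow> integrable M (\<lambda>x. \<phi> (Z 0 x))"
proof -
  have "integrable M (\<lambda>x. \<phi> (Z t x)) \<longleftrightarrow> integrable (distr M borel (Z t)) \<phi>"
    by (simp add: integrable_distr_eq)
  also have "\<dots> \<longleftrightarrow> integrable M (\<lambda>x. \<phi> (Z 0 x))"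
    by (simp add: Z_ident[of t] integrable_distr_eq)
  finally show ?thesis .
qed

lemma expectation_Z_square: "expectation (\<lambda>x. (Z t x)\<^sup>2) = 1"
  using Z_variance[of t] by (simp add: Z_mean)

text \<open>Unit variance excludes a degenerate innovation; this supplies the nonvanishing condition
  when the moments of \<open>X 0\<close> are factored.\<close>

lemma not_AE_Z_eq_0: "\<not> (AE x in M. Z t x = 0)"
proof
  assume "AE x in M. Z t x = 0"
  then have "expectation (\<lambda>x. (Z t x)\<^sup>2) = expectation (\<lambda>x. 0)"
    by (intro integral_cong_AE) auto
  then show False
    by (simp add: expectation_Z_square)
qed

text \<open>Centring always at the mean of \<open>\<bar>Z 0 y\<bar>\<close> gives one map that
  serves every time index, so identical distribution of the \<open>Z t\<close> carries over to their
  images.\<close>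

definition news :: "real \<Rightarrow> real" where
  "news z = \<theta> * z + \<gamma> * (\<bar>z\<bar> - expectation (\<lambda>y. \<bar>Z 0 y\<bar>))"

lemma news_measurable [measurable]: "news \<in> borel_measurable borel"
  unfolding news_def[abs_def] by measurable

lemma fiegarch_g_Z: "fiegarch_g M \<theta> \<gamma> (Z t) x = news (Z t x)"
  using expectation_Z_eq[of abs t] by (simp add: fiegarch_g_def news_def)

text \<open>The random part of the log volatility at time 0. As a \<open>suminf\<close> it is
  defined everywhere as a function of past innovations, and it agrees with the almost sure limit off
  a null set.\<close>

definition news_sum :: "'a \<Rightarrow> real" where
  "news_sum x = (\<Sum>k. lam k * news (Z (- 1 - int k) x))"

lemma news_sum_measurable [measurable]: "news_sum \<in> borel_measurable M"
  unfolding news_sum_def[abs_def] by measurable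

lemma AE_log_volatility_0:
  "AE x in M. (\<lambda>k. lam k * news (Z (- 1 - int k) x)) sums news_sum x \<and>
     ln ((\<sigma> 0 x)\<^sup>2) = \<omega> + news_sum x"
  using log_volatility[of 0]
proof eventually_elim
  fix x
  assume "(\<lambda>n. \<omega> + (\<Sum>k<n. lam k * fiegarch_g M \<theta> \<gamma> (Z (0 - 1 - int k)) x))
    \<longlonglongrightarrow> ln ((\<sigma> 0 x)\<^sup>2)"
  then have "(\<lambda>n. \<omega> + (\<Sum>k<n. lam k * news (Z (- 1 - int k) x)) - \<omega>)
    \<longlonglongrightarrow> ln ((\<sigma> 0 x)\<^sup>2) - \<omega>"
    by (intro tendsto_diff tendsto_const) (simp add: fiegarch_g_Z)
  then have "(\<lambda>k. lam k * news (Z (- 1 - int k) x)) sums (ln ((\<sigma> 0 x)\<^sup>2) - \<omega>)"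
    by (simp add: sums_def)
  then show "(\<lambda>k. lam k * news (Z (- 1 - int k) x)) sums news_sum x \<and>
     ln ((\<sigma> 0 x)\<^sup>2) = \<omega> + news_sum x"
    by (auto simp: news_sum_def sums_iff)
qed

text \<open>Since \<open>\<sigma> 0 x\<close> is the exponential of half the log volatility, its
  power carries \<open>real m / 2\<close>. The deterministic factor in \<open>\<omega>\<close> is
  split off because it later cancels.\<close>

lemma AE_X_0_power:
  "AE x in M. X 0 x ^ m = exp (real m / 2 * \<omega>) * (exp (real m / 2 * news_sum x) * Z 0 x ^ m)"
  using AE_log_volatility_0 AE_space
proof eventually_elim
  fix x assume *: "(\<lambda>k. lam k * news (Z (- 1 - int k) x)) sums news_sum x \<and>
     ln ((\<sigma> 0 x)\<^sup>2) = \<omega> + news_sum x" and x: "x \<in> space M"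
  have "ln (\<sigma> 0 x) = (\<omega> + news_sum x) / 2"
    using * sigma_pos[OF x, of 0] by (simp add: ln_realpow)
  then have "\<sigma> 0 x = exp ((\<omega> + news_sum x) / 2)"
    using sigma_pos[OF x, of 0] by (metis exp_ln)
  then have "\<sigma> 0 x ^ m = exp (real m / 2 * \<omega>) * exp (real m / 2 * news_sum x)"
    by (simp add: exp_of_nat_mult[symmetric] exp_add[symmetric] algebra_simps add_divide_distrib)
  then show "X 0 x ^ m = exp (real m / 2 * \<omega>) * (exp (real m / 2 * news_sum x) * Z 0 x ^ m)"
    by (simp add: X_eq[OF x] power_mult_distrib)
qed

text \<open>The indices \<open>- 1 - int k\<close> are all negative, so the sum and
  \<open>Z 0\<close> read disjoint blocks of the innovations.\<close>

lemma indep_news_sum_Z_0: "indep_var borel news_sum borel (Z 0)"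
proof -
  have "indep_var (PiM {..<0} (\<lambda>_. borel)) (\<lambda>x. restrict (\<lambda>t. Z t x) {..<0})
      (PiM {0} (\<lambda>_. borel)) (\<lambda>x. restrict (\<lambda>t. Z t x) {0})"
    by (rule indep_var_restrict[OF Z_indep]) auto
  then have "indep_var borel
      ((\<lambda>w. \<Sum>k. lam k * news (w (- 1 - int k))) \<circ> (\<lambda>x. restrict (\<lambda>t. Z t x) {..<0}))
      borel ((\<lambda>w. w 0) \<circ> (\<lambda>x. restrict (\<lambda>t. Z t x) {0}))"
    by (rule indep_var_compose) measurable
  also have "(\<lambda>w. \<Sum>k. lam k * news (w (- 1 - int k))) \<circ> (\<lambda>x. restrict (\<lambda>t. Z t x) {..<0})
      = news_sum"
    by (auto simp: news_sum_def fun_eq_iff)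
  also have "(\<lambda>w. w 0) \<circ> (\<lambda>x. restrict (\<lambda>t. Z t x) {0}) = Z 0"
    by auto
  finally show ?thesis .
qed

section \<open>Factorization of moments and passage to the infinite products\<close>

text \<open>The series runs over distinct past innovations, whereas every factor of the product is
  written with \<open>Z 0\<close>; identical distribution exchanges them factor by factor.\<close>

lemma exp_news_sum_moments:
  assumes int: "integrable M (\<lambda>x. exp (c * news_sum x))"
  shows "exp_moment_prod_converges M c lam (fiegarch_g M \<theta> \<gamma> (Z 0))"
    and "exp_moment_prod M c lam (fiegarch_g M \<theta> \<gamma> (Z 0)) = expectation (\<lambda>x. exp (c * news_sum x))"
proof -
  define V where "V k x = c * lam k * news (Z (- 1 - int k) x)" for k x
  have "indep_vars (\<lambda>_. borel) (\<lambda>k. Z (- 1 - int k)) UNIV"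
    by (rule indep_vars_reindex[OF Z_indep]) (auto intro: inj_onI)
  then have ind: "indep_vars (\<lambda>_. borel) V UNIV"
    unfolding V_def[abs_def] by (rule indep_vars_compose2) measurable
  have sums: "AE x in M. (\<lambda>k. V k x) sums (c * news_sum x)"
    using AE_log_volatility_0
    by eventually_elim (auto simp: V_def mult.assoc intro: sums_mult)
  have V_eq: "integrable M (\<lambda>x. exp (V k x))
        \<longleftrightarrow> integrable M (\<lambda>x. exp (c * lam k * fiegarch_g M \<theta> \<gamma> (Z 0) x))"
      "expectation (\<lambda>x. exp (V k x))
        = expectation (\<lambda>x. exp (c * lam k * fiegarch_g M \<theta> \<gamma> (Z 0) x))" for k
    using integrable_Z_iff[of "\<lambda>z. exp (c * lam k * news z)" "- 1 - int k"]
      expectation_Z_eq[of "\<lambda>z. exp (c * lam k * news z)" "- 1 - int k"]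
    by (simp_all add: V_def fiegarch_g_Z)
  have lim: "(\<lambda>n. \<Prod>k<n. expectation (\<lambda>x. exp (c * lam k * fiegarch_g M \<theta> \<gamma> (Z 0) x)))
      \<longlonglongrightarrow> expectation (\<lambda>x. exp (c * news_sum x))"
    using prod_expectation_exp_tendsto[OF ind sums int] by (simp add: V_eq)
  then show "exp_moment_prod_converges M c lam (fiegarch_g M \<theta> \<gamma> (Z 0))"
    using integrable_exp_summand[OF ind sums int]
    by (auto simp: exp_moment_prod_converges_def V_eq convergent_def)
  show "exp_moment_prod M c lam (fiegarch_g M \<theta> \<gamma> (Z 0)) = expectation (\<lambda>x. exp (c * news_sum x))"
    using lim by (simp add: exp_moment_prod_def limI)
qed

lemma
  assumes int: "integrable M (\<lambda>x. \<bar>X 0 x\<bar> ^ m)" and m: "0 < m"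
  shows integrable_exp_news_sum: "integrable M (\<lambda>x. exp (real m / 2 * news_sum x))"
    and integrable_Z_power: "integrable M (\<lambda>x. Z 0 x ^ m)"
    and expectation_X_power: "expectation (\<lambda>x. X 0 x ^ m) = exp (real m / 2 * \<omega>) *
      (expectation (\<lambda>x. exp (real m / 2 * news_sum x)) * expectation (\<lambda>x. Z 0 x ^ m))"
proof -
  let ?f = "\<lambda>x. exp (real m / 2 * news_sum x)"
  have X_measurable [measurable]: "X 0 \<in> borel_measurable M"
    by (rule measurable_cong[THEN iffD2, OF X_eq[of _ 0]]) (use sigma_measurable in auto)
  have ind: "indep_var borel ?f borel (\<lambda>x. \<phi> (Z 0 x))"
    if [measurable]: "\<phi> \<in> borel_measurable borel" for \<phi> :: "real \<Rightarrow> real"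
    using indep_var_compose[OF indep_news_sum_Z_0,
        of "\<lambda>s. exp (real m / 2 * s)" borel \<phi> borel]
    by (simp add: comp_def)
  have "integrable M (\<lambda>x. \<bar>X 0 x\<bar> ^ m / exp (real m / 2 * \<omega>))"
    using int by simp
  \<comment> \<open>Absolute values keep both factors nonnegative, as the splitting of integrability
    requires. The sign of \<open>Z 0\<close> returns only in the expectation.\<close>
  then have prod: "integrable M (\<lambda>x. ?f x * \<bar>Z 0 x\<bar> ^ m)"
  proof (rule integrable_cong_AE_imp)
    show "AE x in M. \<bar>X 0 x\<bar> ^ m / exp (real m / 2 * \<omega>) = ?f x * \<bar>Z 0 x\<bar> ^ m"
      using AE_X_0_power[of m] by eventually_elim (simp add: power_abs[symmetric] abs_mult)
  qed measurable
  have "\<not> (AE x in M. \<bar>Z 0 x\<bar> ^ m = 0)"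
    using not_AE_Z_eq_0[of 0] m by simp
  note fac = indep_var_integrable_factors[OF ind[of "\<lambda>z. \<bar>z\<bar> ^ m"] _ _ prod not_AE_eq_0_exp this]
  show int_f: "integrable M ?f"
    by (rule fac(1)) auto
  have "integrable M (\<lambda>x. \<bar>Z 0 x\<bar> ^ m)"
    by (rule fac(2)) auto
  then show int_Z: "integrable M (\<lambda>x. Z 0 x ^ m)"
    by (rule Bochner_Integration.integrable_bound) (auto simp: power_abs)
  have "expectation (\<lambda>x. X 0 x ^ m)
      = expectation (\<lambda>x. exp (real m / 2 * \<omega>) * (?f x * Z 0 x ^ m))"
    using AE_X_0_power[of m] by (intro integral_cong_AE) auto
  also have "\<dots> = exp (real m / 2 * \<omega>) * (expectation ?f * expectation (\<lambda>x. Z 0 x ^ m))"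
    using indep_var_lebesgue_integral[OF ind[of "\<lambda>z. z ^ m"] int_f int_Z] by simp
  finally show "expectation (\<lambda>x. X 0 x ^ m) = exp (real m / 2 * \<omega>) *
      (expectation ?f * expectation (\<lambda>x. Z 0 x ^ m))" .
qed

text \<open>Both the \<open>m\<close>-th moment and the second moment raised to
  \<open>real m / 2\<close> contain \<open>exp (real m / 2 * \<omega>)\<close>, which cancels. The
  cases \<open>m = 3\<close> and \<open>m = 4\<close> give asymmetry and kurtosis.\<close>

lemma moment_ratio:
  assumes stat: "strictly_stationary M X"
    and int: "integrable M (\<lambda>x. \<bar>X 0 x\<bar> ^ m)" and m: "2 \<le> m"
  defines "g0 \<equiv> fiegarch_g M \<theta> \<gamma> (Z 0)"
  shows "integrable M (\<lambda>x. Z 0 x ^ m)"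
    and "exp_moment_prod_converges M (real m / 2) lam g0"
    and "exp_moment_prod_converges M 1 lam g0"
    and "0 < exp_moment_prod M 1 lam g0"
    and "expectation (\<lambda>x. X t x ^ m) / expectation (\<lambda>x. (X t x)\<^sup>2) powr (real m / 2) =
      expectation (\<lambda>x. Z 0 x ^ m) *
      (exp_moment_prod M (real m / 2) lam g0 / exp_moment_prod M 1 lam g0 powr (real m / 2))"
proof -
  have X_measurable [measurable]: "X t \<in> borel_measurable M" for t
    using stat by (auto simp: strictly_stationary_def)
  have X_moment: "expectation (\<lambda>x. X t x ^ n) = expectation (\<lambda>x. X 0 x ^ n)" for n
  proof -
    \<comment> \<open>Stationarity is applied to the one-point index set \<open>{0}\<close> with
      shift \<open>t\<close>; evaluating the coordinate 0 then compares the moments of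
      \<open>X t\<close> and \<open>X 0\<close>.\<close>
    let ?P = "PiM {0::int} (\<lambda>_. borel :: real measure)"
    have eq: "distr M ?P (\<lambda>x. \<lambda>s\<in>{0}. X (s + t) x) = distr M ?P (\<lambda>x. \<lambda>s\<in>{0}. X s x)"
      using stat unfolding strictly_stationary_def by blast
    have [measurable]: "(\<lambda>w. w 0 ^ n) \<in> borel_measurable ?P"
      by measurable
    have "integral\<^sup>L (distr M ?P (\<lambda>x. \<lambda>s\<in>{0}. X (s + t) x)) (\<lambda>w. w 0 ^ n)
        = integral\<^sup>L (distr M ?P (\<lambda>x. \<lambda>s\<in>{0}. X s x)) (\<lambda>w. w 0 ^ n)"
      by (simp only: eq)
    then show ?thesis
      by (subst (asm) (1 2) integral_distr) (auto intro!: measurable_restrict)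
  qed
  have int2: "integrable M (\<lambda>x. \<bar>X 0 x\<bar> ^ 2)"
  proof (rule Bochner_Integration.integrable_bound)
    show "integrable M (\<lambda>x. 1 + \<bar>X 0 x\<bar> ^ m)"
      using int by simp
    have "y ^ 2 \<le> 1 + y ^ m" if "0 \<le> y" for y :: real
    proof (cases "y \<le> 1")
      case True
      with that have "y ^ 2 \<le> 1"
        by (simp add: power_le_one)
      with that show ?thesis
        by (simp add: add_increasing2)
    next
      case False
      with m have "y ^ 2 \<le> y ^ m"
        by (intro power_increasing) auto
      then show ?thesis
        by simp
    qed
    from this[of "\<bar>X 0 x\<bar>" for x]
    show "AE x in M. norm (\<bar>X 0 x\<bar> ^ 2) \<le> norm (1 + \<bar>X 0 x\<bar> ^ m)"
      by (simp add: abs_of_nonneg)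
  qed measurable
  from m have m0: "0 < m"
    by simp
  note E = integrable_exp_news_sum[OF int m0]
  \<comment> \<open>For exponent 2 the factor \<open>real m / 2\<close> is 1, which gives the
    product in the denominator.\<close>
  note E2 = integrable_exp_news_sum[OF int2, simplified]
  show "integrable M (\<lambda>x. Z 0 x ^ m)"
    using int m0 by (rule integrable_Z_power)
  show "exp_moment_prod_converges M (real m / 2) lam g0"
    unfolding g0_def by (rule exp_news_sum_moments(1)[OF E])
  show "exp_moment_prod_converges M 1 lam g0"
    unfolding g0_def by (rule exp_news_sum_moments(1)) (simp add: E2)
  have P: "exp_moment_prod M (real m / 2) lam g0 = expectation (\<lambda>x. exp (real m / 2 * news_sum x))"
    unfolding g0_def by (rule exp_news_sum_moments(2)[OF E])
  have P1: "exp_moment_prod M 1 lam g0 = expectation (\<lambda>x. exp (news_sum x))"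
    unfolding g0_def by (subst exp_news_sum_moments(2)) (simp_all add: E2)
  show pos: "0 < exp_moment_prod M 1 lam g0"
    unfolding P1 using E2 by (intro expectation_greater) auto
  \<comment> \<open>The factor coming from \<open>Z 0\<close> is its second moment, which equals
    1.\<close>
  have "expectation (\<lambda>x. (X t x)\<^sup>2) = exp \<omega> * exp_moment_prod M 1 lam g0"
    using expectation_X_power[OF int2] by (simp add: X_moment P1 expectation_Z_square)
  moreover have "(exp \<omega> * exp_moment_prod M 1 lam g0) powr (real m / 2)
      = exp (real m / 2 * \<omega>) * exp_moment_prod M 1 lam g0 powr (real m / 2)"
    using pos by (simp add: powr_mult) (simp add: powr_def)
  ultimately show "expectation (\<lambda>x. X t x ^ m) / expectation (\<lambda>x. (X t x)\<^sup>2) powr (real m / 2) =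
      expectation (\<lambda>x. Z 0 x ^ m) *
      (exp_moment_prod M (real m / 2) lam g0 / exp_moment_prod M 1 lam g0 powr (real m / 2))"
    using expectation_X_power[OF int m0] by (simp add: X_moment P)
qed

end

theorem proposition3:
  fixes M :: "'a measure"
    and p q :: nat
    and \<alpha> \<beta> lam :: "nat \<Rightarrow> real"
    and d \<omega> \<theta> \<gamma> :: real
    and Z \<sigma> X :: "int \<Rightarrow> 'a \<Rightarrow> real"
  assumes "fiegarch M p q \<alpha> \<beta> d \<omega> \<theta> \<gamma> lam Z \<sigma> X"
    and "strictly_stationary M X"
    and "d < 1/2"
  defines "g0 \<equiv> fiegarch_g M \<theta> \<gamma> (Z 0)"
  shows "(integrable M (\<lambda>x. \<bar>X 0 x\<bar> ^ 3) \<longrightarrow>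
            integrable M (\<lambda>x. (Z 0 x) ^ 3) \<and>
            exp_moment_prod_converges M (3/2) lam g0 \<and>
            exp_moment_prod_converges M 1 lam g0 \<and>
            exp_moment_prod M 1 lam g0 > 0 \<and>
            (\<forall>t. asymmetry_measure M (X t) =
               (\<integral>x. (Z 0 x) ^ 3 \<partial>M) *
               (exp_moment_prod M (3/2) lam g0 / exp_moment_prod M 1 lam g0 powr (3/2))))
       \<and> (integrable M (\<lambda>x. (X 0 x) ^ 4) \<longrightarrow>
            integrable M (\<lambda>x. (Z 0 x) ^ 4) \<and>
            exp_moment_prod_converges M 2 lam g0 \<and>
            exp_moment_prod_converges M 1 lam g0 \<and>
            exp_moment_prod M 1 lam g0 > 0 \<and>
            (\<forall>t. kurtosis_measure M (X t) =
               (\<integral>x. (Z 0 x) ^ 4 \<partial>M) *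
               (exp_moment_prod M 2 lam g0 / (exp_moment_prod M 1 lam g0)\<^sup>2)))"
proof -
  interpret fiegarch M p q \<alpha> \<beta> d \<omega> \<theta> \<gamma> lam Z \<sigma> X
    by fact
  note ratio = moment_ratio[OF \<open>strictly_stationary M X\<close>, folded g0_def]
  have nonneg: "0 \<le> expectation (\<lambda>x. (X t x)\<^sup>2)" for t
    by simp
  \<comment> \<open>The kurtosis is defined with a square, whereas the ratio for
    \<open>m = 4\<close> has a real power with exponent 2; they agree on nonnegative bases.\<close>
  have powr2: "y powr 2 = y\<^sup>2" if "0 \<le> y" for y :: real
    using that powr_realpow'[of y 2] by simp
  show ?thesis
    using ratio[of 3] ratio[of 4]
    by (auto simp: asymmetry_measure_def kurtosis_measure_def powr2 less_imp_le nonneg)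
qed

end
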